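(* For every integer $n \geq 2$ and every $k \in \mathbb{N}_{+}$, there is a transparent strategy for Presenter in the $n$-round, $k$-bounded on-line graph coloring game that forces Algorithm to use at least $2\frac{n}{\log n + 3}$ different colors, and in which Presenter's own (transparent) coloring uses at most $\frac{n}{k} + \log n + 3$ colors. Here $\log$ denotes the logarithm to base $2$.
   Context: A proper coloring of a graph $G$ assigns colors to the vertices so that adjacent vertices receive distinct colors. A $k$-bounded coloring of $G$ is a proper coloring in which each single color is assigned to at most $k$ vertices. The $n$-round, $k$-bounded on-line graph coloring game is played by two players, Presenter and Algorithm, for $n$ rounds. In each round Presenter introduces a new vertex of a graph together with its adjacency status to all vertices presented earlier. Algorithm then irrevocably assigns a color to the new vertex, before the next vertex is introduced, in such a way that the coloring of the presented graph constructed by Algorithm is a $k$-bounded coloring. Algorithm may use any number of colors and aims to minimize the number of different colors used. A strategy for Presenter is transparent if, each time after Algorithm assigns a color to a vertex, Presenter also irrevocably colors that vertex with a color of his own and reveals that color to Algorithm; the coloring constructed by Presenter must satisfy the same conditions as the coloring constructed by Algorithm (that is, it must be a $k$-bounded coloring of the presented graph). A strategy for Presenter "forces Algorithm to use at least $c$ colors" if, whatever valid choices Algorithm makes, at the end of the game played against this strategy Algorithm has used at least $c$ different colors. *)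

theory Defs
  imports Complex_Main
begin

text \<open>A graph is given by its vertex set \<open>V\<close> and its set \<open>E\<close> of edges, which are
  two-element subsets of \<open>V\<close>.\<close>

definition proper_coloring :: "'v set \<Rightarrow> 'v set set \<Rightarrow> ('v \<Rightarrow> 'c) \<Rightarrow> bool" where
  "proper_coloring V E f \<longleftrightarrow> (\<forall>u\<in>V. \<forall>v\<in>V. {u, v} \<in> E \<longrightarrow> f u \<noteq> f v)"

definition bounded_coloring :: "nat \<Rightarrow> 'v set \<Rightarrow> 'v set set \<Rightarrow> ('v \<Rightarrow> 'c) \<Rightarrow> bool" where
  "bounded_coloring k V E f \<longleftrightarrow>
     proper_coloring V E f \<and> (\<forall>c. finite {v \<in> V. f v = c} \<and> card {v \<in> V. f v = c} \<le> k)"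

text \<open>Vertex \<open>i\<close> is the one presented in round \<open>i\<close>, counting from \<open>0\<close>. A round consists of the
  set of earlier vertices adjacent to the new vertex, the color assigned to it by Algorithm, and
  the color then assigned to it by Presenter. A history lists the completed rounds in
  chronological order. Colors are natural numbers, so both players always have a fresh color.\<close>

datatype round = Round (neighbors: "nat set") (alg_color: nat) (pres_color: nat)

type_synonym history = "round list"

definition vertices :: "history \<Rightarrow> nat set" where
  "vertices h = {..<length h}"

definition edges :: "history \<Rightarrow> nat set set" where
  "edges h = {{u, v} |u v. u < v \<and> v < length h \<and> u \<in> neighbors (h ! v)}"

definition alg_coloring :: "history \<Rightarrow> nat \<Rightarrow> nat" where
  "alg_coloring h v = alg_color (h ! v)"

definition pres_coloring :: "history \<Rightarrow> nat \<Rightarrow> nat" where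
  "pres_coloring h v = pres_color (h ! v)"

text \<open>\<open>introduce S h\<close> is the neighborhood of the next vertex after history \<open>h\<close>, and
  \<open>respond S h a\<close> is the color Presenter gives to that vertex after Algorithm has colored it
  with \<open>a\<close>.\<close>

record strategy =
  introduce :: "history \<Rightarrow> nat set"
  respond :: "history \<Rightarrow> nat \<Rightarrow> nat"

definition next_history :: "strategy \<Rightarrow> history \<Rightarrow> nat \<Rightarrow> history" where
  "next_history S h a = h @ [Round (introduce S h) a (respond S h a)]"

text \<open>The histories that arise when Presenter follows \<open>S\<close> and Algorithm makes arbitrary valid
  choices.\<close>

inductive play :: "nat \<Rightarrow> strategy \<Rightarrow> history \<Rightarrow> bool" for k S where
  start: "play k S []"
| step: "play k S h \<Longrightarrow> h' = next_history S h a \<Longrightarrow>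
    bounded_coloring k (vertices h') (edges h') (alg_coloring h') \<Longrightarrow> play k S h'"

text \<open>\<open>S\<close> only ever makes moves permitted by the rules of the \<open>n\<close>-round game.\<close>

definition transparent_strategy :: "nat \<Rightarrow> nat \<Rightarrow> strategy \<Rightarrow> bool" where
  "transparent_strategy n k S \<longleftrightarrow>
     (\<forall>h. play k S h \<and> length h < n \<longrightarrow> introduce S h \<subseteq> vertices h) \<and>
     (\<forall>h. play k S h \<and> length h \<le> n \<longrightarrow>
        bounded_coloring k (vertices h) (edges h) (pres_coloring h))"

definition forces_colors :: "nat \<Rightarrow> nat \<Rightarrow> strategy \<Rightarrow> real \<Rightarrow> bool" where
  "forces_colors n k S c \<longleftrightarrow>
     (\<forall>h. play k S h \<and> length h = n \<longrightarrow> c \<le> real (card (alg_coloring h ` vertices h)))"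

definition presenter_uses_at_most :: "nat \<Rightarrow> nat \<Rightarrow> strategy \<Rightarrow> real \<Rightarrow> bool" where
  "presenter_uses_at_most n k S c \<longleftrightarrow>
     (\<forall>h. play k S h \<and> length h = n \<longrightarrow> real (card (pres_coloring h ` vertices h)) \<le> c)"

end

theory Submission
  imports Defs
begin

text \<open>This is the Halldorsson--Szegedy lower bound with color recycling. Presenter maintains a
  palette of at least \<open>2s\<close> colors that he has used fewer than \<open>k\<close> times; a color used \<open>k\<close> times is
  replaced by a fresh one. Call the set of Presenter's colors on one of Algorithm's color
  classes its hue. In each round Presenter picks an \<open>s\<close>-element subset \<open>A\<close> of the palette that is
  not a hue, and joins the new vertex to all vertices whose color lies outside \<open>A\<close>. Whatever class
  Algorithm selects has a hue properly contained in \<open>A\<close>, so Presenter can color the new vertex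
  with an element of \<open>A\<close> that is missing from that hue. Therefore each of Algorithm's classes
  receives pairwise distinct Presenter colors and never exceeds size \<open>s\<close>. The set \<open>A\<close> exists as
  long as fewer than \<open>(2s choose s)\<close> classes are full, which holds for \<open>n \<le> s (2s choose s)\<close> rounds;
  \<open>s = \<lfloor>(\<lfloor>log n\<rfloor> + 3) / 2\<rfloor>\<close> suffices because \<open>(2s choose s) \<ge> 4^s / (2s)\<close>.\<close>

text \<open>Pigeonhole, needed for two kinds of classes: Presenter's colors on at least
  \<open>k\<close> vertices and Algorithm's classes with at least \<open>s\<close>. As
  \<open>q \<ge> 1\<close>, such classes are nonempty, so their colors lie in the finite image of
  \<open>S\<close>.\<close>

lemma card_large_classes:
  assumes "finite S" and "q \<ge> 1"
  shows "finite {c. q \<le> card {v \<in> S. f v = c}}"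
    and "q * card {c. q \<le> card {v \<in> S. f v = c}} \<le> card S"
proof -
  let ?T = "{c. q \<le> card {v \<in> S. f v = c}}"
  have sub: "?T \<subseteq> f ` S"
  proof
    fix c assume "c \<in> ?T"
    then have "{v \<in> S. f v = c} \<noteq> {}"
      using assms(2) by (metis (mono_tags) card.empty mem_Collect_eq not_one_le_zero order_trans)
    then show "c \<in> f ` S" by auto
  qed
  then show "finite ?T" using assms(1) finite_surj by blast
  have "q * card ?T = (\<Sum>c\<in>?T. q)" by simp
  also have "\<dots> \<le> (\<Sum>c\<in>?T. card {v \<in> S. f v = c})" by (rule sum_mono) simp
  also have "\<dots> \<le> (\<Sum>c\<in>f ` S. card {v \<in> S. f v = c})"
    using sub assms(1) by (intro sum_mono2) auto
  also have "\<dots> = card S" using sum.image_gen[OF assms(1), of "\<lambda>_. 1::nat" f] by simp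
  finally show "q * card ?T \<le> card S" .
qed

lemma card_le_classes:
  assumes "finite S" and "\<And>c. card {v \<in> S. f v = c} \<le> q"
  shows "card S \<le> q * card (f ` S)"
proof -
  have "card S = (\<Sum>c\<in>f ` S. card {v \<in> S. f v = c})"
    using sum.image_gen[OF assms(1), of "\<lambda>_. 1::nat" f] by simp
  also have "\<dots> \<le> (\<Sum>c\<in>f ` S. q)" using assms(2) by (rule sum_mono)
  finally show ?thesis by (simp add: mult.commute)
qed

section \<open>Effect of one more round on edges, colorings and color classes\<close>

lemma proper_coloring_edges_iff:
  "proper_coloring (vertices h) (edges h) f \<longleftrightarrow>
    (\<forall>v<length h. \<forall>u<v. u \<in> neighbors (h ! v) \<longrightarrow> f u \<noteq> f v)"
proof
  assume proper: "proper_coloring (vertices h) (edges h) f"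
  show "\<forall>v<length h. \<forall>u<v. u \<in> neighbors (h ! v) \<longrightarrow> f u \<noteq> f v"
  proof (intro allI impI)
    fix v u assume uv: "v < length h" "u < v" "u \<in> neighbors (h ! v)"
    then have "{u, v} \<in> edges h" unfolding edges_def by blast
    then show "f u \<noteq> f v" using proper uv by (simp add: proper_coloring_def vertices_def)
  qed
next
  assume "\<forall>v<length h. \<forall>u<v. u \<in> neighbors (h ! v) \<longrightarrow> f u \<noteq> f v"
  then show "proper_coloring (vertices h) (edges h) f"
    unfolding proper_coloring_def edges_def by (fastforce simp: doubleton_eq_iff)
qed

lemma vertices_snoc: "vertices (h @ [r]) = insert (length h) (vertices h)"
  by (auto simp: vertices_def)

lemma coloring_snoc:
  "v \<in> vertices h \<Longrightarrow> alg_coloring (h @ [r]) v = alg_coloring h v"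
  "v \<in> vertices h \<Longrightarrow> pres_coloring (h @ [r]) v = pres_coloring h v"
  "alg_coloring (h @ [r]) (length h) = alg_color r"
  "pres_coloring (h @ [r]) (length h) = pres_color r"
  by (simp_all add: alg_coloring_def pres_coloring_def vertices_def nth_append)

lemma finite_vertices [simp]: "finite (vertices h)"
  and card_vertices [simp]: "card (vertices h) = length h"
  and length_notin_vertices [simp]: "length h \<notin> vertices h"
  by (simp_all add: vertices_def)

lemma proper_coloring_snoc:
  "proper_coloring (vertices (h @ [r])) (edges (h @ [r])) f \<longleftrightarrow>
    proper_coloring (vertices h) (edges h) f \<and>
    (\<forall>u\<in>vertices h. u \<in> neighbors r \<longrightarrow> f u \<noteq> f (length h))"
  unfolding proper_coloring_edges_iff
  by (auto simp: vertices_def nth_append less_Suc_eq)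

lemma proper_coloring_cong:
  assumes "\<And>v. v \<in> V \<Longrightarrow> f v = g v"
  shows "proper_coloring V E f \<longleftrightarrow> proper_coloring V E g"
  using assms by (auto simp: proper_coloring_def)

definition alg_class :: "history \<Rightarrow> nat \<Rightarrow> nat set" where
  "alg_class h a = {v \<in> vertices h. alg_coloring h v = a}"

definition pres_class :: "history \<Rightarrow> nat \<Rightarrow> nat set" where
  "pres_class h c = {v \<in> vertices h. pres_coloring h v = c}"

lemma finite_classes [simp]: "finite (alg_class h a)" "finite (pres_class h c)"
  by (simp_all add: alg_class_def pres_class_def)

lemma alg_class_snoc:
  "alg_class (h @ [r]) a =
    (if alg_color r = a then insert (length h) (alg_class h a) else alg_class h a)"
  by (auto simp: alg_class_def vertices_snoc coloring_snoc)

lemma pres_class_snoc: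
  "pres_class (h @ [r]) c =
    (if pres_color r = c then insert (length h) (pres_class h c) else pres_class h c)"
  by (auto simp: pres_class_def vertices_snoc coloring_snoc)

section \<open>Hues, palette and Presenter's strategy\<close>

definition hue :: "history \<Rightarrow> nat \<Rightarrow> nat set" where
  "hue h a = pres_coloring h ` alg_class h a"

definition exhausted :: "nat \<Rightarrow> history \<Rightarrow> nat set" where
  "exhausted k h = {c. k \<le> card (pres_class h c)}"

text \<open>The end of the interval rises by one with every exhausted color, which supplies the
  fresh replacement.\<close>

definition palette :: "nat \<Rightarrow> nat \<Rightarrow> history \<Rightarrow> nat set" where
  "palette k s h = {..<card (exhausted k h) + 2 * s} - exhausted k h"

definition admissible :: "nat \<Rightarrow> nat \<Rightarrow> history \<Rightarrow> nat set \<Rightarrow> bool" where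
  "admissible k s h A \<longleftrightarrow> A \<subseteq> palette k s h \<and> card A = s \<and> A \<notin> range (hue h)"

text \<open>The choice depends on the history alone, so \<open>introduce\<close> and
  \<open>respond\<close> share the same set without any stored state.\<close>

definition avail :: "nat \<Rightarrow> nat \<Rightarrow> history \<Rightarrow> nat set" where
  "avail k s h = (SOME A. admissible k s h A)"

definition hue_strategy :: "nat \<Rightarrow> nat \<Rightarrow> strategy" where
  "hue_strategy k s =
    \<lparr>introduce = (\<lambda>h. {u \<in> vertices h. pres_coloring h u \<notin> avail k s h}),
     respond = (\<lambda>h a. SOME c. c \<in> avail k s h - hue h a)\<rparr>"

text \<open>Injectivity makes a hue as large as its class, so only classes of size \<open>s\<close>
  can block an \<open>s\<close>-element set. The interval bounds the number of colors Presenter has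
  used so far.\<close>

definition hue_invariant :: "nat \<Rightarrow> nat \<Rightarrow> history \<Rightarrow> bool" where
  "hue_invariant k s h \<longleftrightarrow>
    proper_coloring (vertices h) (edges h) (pres_coloring h) \<and>
    (\<forall>c. card (pres_class h c) \<le> k) \<and>
    pres_coloring h ` vertices h \<subseteq> {..<card (exhausted k h) + 2 * s} \<and>
    (\<forall>a. inj_on (pres_coloring h) (alg_class h a) \<and> card (alg_class h a) \<le> s)"

section \<open>Existence of the set A and preservation of the invariant\<close>

lemma exhausted_bound:
  assumes "k \<ge> 1"
  shows "finite (exhausted k h)" and "k * card (exhausted k h) \<le> length h"
  using card_large_classes[of "vertices h" k "pres_coloring h"] assms
  by (simp_all add: exhausted_def pres_class_def)

lemma exhausted_snoc: "exhausted k h \<subseteq> exhausted k (h @ [r])"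
  by (auto simp: exhausted_def pres_class_snoc card_insert_if)

lemma card_palette:
  assumes "k \<ge> 1"
  shows "2 * s \<le> card (palette k s h)"
  using diff_card_le_card_Diff[OF exhausted_bound(1)[OF assms, of h],
      of "{..<card (exhausted k h) + 2 * s}"]
  by (simp add: palette_def)

lemma admissible_avail:
  assumes "k \<ge> 1" and "s \<ge> 1" and "hue_invariant k s h"
    and "length h < s * (2 * s choose s)"
  shows "admissible k s h (avail k s h)"
proof -
  let ?full = "{a. s \<le> card (alg_class h a)}"
  let ?subsets = "{A. A \<subseteq> palette k s h \<and> card A = s}"
  have full: "finite ?full" "s * card ?full \<le> length h"
    using card_large_classes[of "vertices h" s "alg_coloring h"] assms(2)
    by (simp_all add: alg_class_def)
  have "card (hue h ` ?full) \<le> card ?full" using full(1) by (rule card_image_le)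
  \<comment> \<open>Full classes are disjoint with at least \<open>s\<close> vertices each, so the
    bound on \<open>length h\<close> can be divided by \<open>s\<close>.\<close>
  also have "\<dots> < (2 * s choose s)"
    using le_less_trans[OF full(2) assms(4)] by simp
  also have "\<dots> \<le> (card (palette k s h) choose s)"
    using card_palette[OF assms(1)] by (rule binomial_right_mono)
  also have "\<dots> = card ?subsets" by (simp add: n_subsets palette_def)
  finally have "\<not> ?subsets \<subseteq> hue h ` ?full"
    using full(1) by (meson card_mono finite_imageI not_le)
  then obtain A where A: "A \<subseteq> palette k s h" "card A = s" "A \<notin> hue h ` ?full" by blast
  have "A \<noteq> hue h a" for a
  proof
    assume eq: "A = hue h a"
    have "card (hue h a) = card (alg_class h a)"
      using assms(3) by (simp add: hue_def hue_invariant_def card_image)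
    then show False using A eq by auto
  qed
  then have "admissible k s h A" using A by (auto simp: admissible_def)
  then show ?thesis unfolding avail_def by (rule someI)
qed

lemma hue_invariant_step:
  assumes k: "k \<ge> 1" and s: "s \<ge> 1" and inv: "hue_invariant k s h"
    and len: "length h < s * (2 * s choose s)"
    and h': "h' = next_history (hue_strategy k s) h a"
    and alg: "proper_coloring (vertices h') (edges h') (alg_coloring h')"
  shows "hue_invariant k s h'"
proof -
  define A where "A = avail k s h"
  define c where "c = respond (hue_strategy k s) h a"
  define r where "r = Round {u \<in> vertices h. pres_coloring h u \<notin> A} a c"
  have h'r: "h' = h @ [r]"
    by (simp add: h' next_history_def r_def c_def A_def hue_strategy_def)
  have A: "A \<subseteq> palette k s h" "card A = s" "A \<notin> range (hue h)"
    using admissible_avail[OF k s inv len] by (auto simp: admissible_def A_def)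
  \<comment> \<open>An infinite set would have \<open>card\<close> 0, which \<open>s \<ge> 1\<close>
    excludes.\<close>
  then have finA: "finite A" using s by (metis card.infinite not_one_le_zero)
  \<comment> \<open>A vertex of class \<open>a\<close> with Presenter color outside \<open>A\<close>
    would be adjacent to the new vertex, against properness of Algorithm's coloring.\<close>
  have "hue h a \<subseteq> A"
  proof -
    have "pres_coloring h u \<in> A" if "u \<in> vertices h" "alg_coloring h u = a" for u
      using alg that unfolding h'r proper_coloring_snoc
      by (auto simp: coloring_snoc r_def)
    then show ?thesis by (auto simp: hue_def alg_class_def)
  qed
  \<comment> \<open>Since \<open>A\<close> is not a hue, the inclusion is strict, and the
    \<open>SOME\<close> in \<open>respond\<close> has a witness.\<close>
  with A(3) have "A - hue h a \<noteq> {}" by blast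
  then have c: "c \<in> A" "c \<notin> hue h a"
    using someI_ex[of "\<lambda>c. c \<in> A - hue h a"] by (auto simp: c_def hue_strategy_def A_def)
  have inv_h: "proper_coloring (vertices h) (edges h) (pres_coloring h)"
      "\<And>c. card (pres_class h c) \<le> k"
      "pres_coloring h ` vertices h \<subseteq> {..<card (exhausted k h) + 2 * s}"
      "\<And>a. inj_on (pres_coloring h) (alg_class h a)" "\<And>a. card (alg_class h a) \<le> s"
    using inv by (auto simp: hue_invariant_def)
  \<comment> \<open>The neighbors of the new vertex have Presenter colors outside \<open>A\<close>,
    while \<open>c\<close> lies in \<open>A\<close>.\<close>
  have proper: "proper_coloring (vertices h') (edges h') (pres_coloring h')"
    using inv_h(1) proper_coloring_cong[of "vertices h" "pres_coloring h'" "pres_coloring h"] c(1)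
    unfolding h'r proper_coloring_snoc
    by (auto simp: coloring_snoc r_def)
  \<comment> \<open>Palette colors are not exhausted, so one more use stays within
    \<open>k\<close>.\<close>
  have "card (pres_class h c) < k"
    using c(1) A(1) by (auto simp: palette_def exhausted_def)
  then have bounded: "card (pres_class h' d) \<le> k" for d
    using inv_h(2)[of d] by (auto simp: h'r pres_class_snoc r_def card_insert_if)
  have "card (exhausted k h) \<le> card (exhausted k h')"
    unfolding h'r using exhausted_bound(1)[OF k] exhausted_snoc by (rule card_mono)
  moreover have "c < card (exhausted k h) + 2 * s" using c(1) A(1) by (auto simp: palette_def)
  ultimately have range: "pres_coloring h' ` vertices h' \<subseteq> {..<card (exhausted k h') + 2 * s}"
    using inv_h(3) by (fastforce simp: h'r vertices_snoc coloring_snoc r_def)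
  have old: "pres_coloring h' u = pres_coloring h u" if "u \<in> alg_class h b" for u b
    using that by (simp add: h'r coloring_snoc alg_class_def)
  have image: "pres_coloring h' ` alg_class h a = hue h a"
    unfolding hue_def using old by (rule image_cong[OF refl])
  have class_eq: "alg_class h' b = (if b = a then insert (length h) (alg_class h a) else alg_class h b)"
    for b by (simp add: h'r alg_class_snoc r_def)
  have new: "pres_coloring h' (length h) = c" by (simp add: h'r coloring_snoc r_def)
  have inj: "inj_on (pres_coloring h') (alg_class h' b)" for b
  proof -
    have "inj_on (pres_coloring h') (alg_class h d)" for d
      using inv_h(4) old by (simp cong: inj_on_cong)
    moreover have "c \<notin> pres_coloring h' ` (alg_class h a - {length h})"
      using c(2) image by blast
    ultimately show ?thesis by (simp add: class_eq new)
  qed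
  have size: "card (alg_class h' b) \<le> s" for b
  proof (cases "b = a")
    case True
    \<comment> \<open>Even the growing class is mapped injectively into \<open>A\<close>, which caps
      its size at \<open>s\<close>.\<close>
    have "pres_coloring h' ` alg_class h' a \<subseteq> A"
      using \<open>hue h a \<subseteq> A\<close> c(1) by (simp add: class_eq new image)
    then show ?thesis using card_inj_on_le[OF inj _ finA] A(2) True by simp
  next
    case False
    then show ?thesis using inv_h(5) by (simp add: class_eq)
  qed
  show ?thesis using proper bounded range inj size by (simp add: hue_invariant_def)
qed

lemma hue_invariant_play:
  assumes "k \<ge> 1" and "s \<ge> 1" and "play k (hue_strategy k s) h"
    and "length h \<le> s * (2 * s choose s)"
  shows "hue_invariant k s h"
  using assms(3,4)
proof (induction rule: play.induct)
  case start
  then show ?case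
    by (simp add: hue_invariant_def proper_coloring_def vertices_def pres_class_def alg_class_def)
next
  case (step h h' a)
  \<comment> \<open>\<open>h'\<close> is one round longer than \<open>h\<close>, which gives the
    strict bound needed to find \<open>A\<close>.\<close>
  then have "length h < s * (2 * s choose s)" by (simp add: next_history_def)
  with step show ?case
    using hue_invariant_step[OF assms(1,2)] by (simp add: bounded_coloring_def)
qed

section \<open>Color counts for both players and the choice of s\<close>

lemma hue_strategy_wins:
  assumes "k \<ge> 1" and "s \<ge> 1" and n: "n \<le> s * (2 * s choose s)"
  shows "transparent_strategy n k (hue_strategy k s)"
    and "forces_colors n k (hue_strategy k s) (real n / real s)"
    and "presenter_uses_at_most n k (hue_strategy k s) (real n / real k + 2 * real s)"
proof -
  have inv: "hue_invariant k s h" if "play k (hue_strategy k s) h" "length h \<le> n" for h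
    using hue_invariant_play[OF assms(1,2) that(1)] that(2) n by simp
  then show "transparent_strategy n k (hue_strategy k s)"
    by (auto simp: transparent_strategy_def hue_strategy_def bounded_coloring_def
        hue_invariant_def pres_class_def)
  show "forces_colors n k (hue_strategy k s) (real n / real s)"
    unfolding forces_colors_def
  proof (intro allI impI)
    fix h assume h: "play k (hue_strategy k s) h \<and> length h = n"
    then have "card (alg_class h a) \<le> s" for a using inv by (simp add: hue_invariant_def)
    then have "n \<le> s * card (alg_coloring h ` vertices h)"
      using card_le_classes[of "vertices h" "alg_coloring h" s] h by (simp add: alg_class_def)
    then have "real n \<le> real s * real (card (alg_coloring h ` vertices h))"
      by (metis of_nat_le_iff of_nat_mult)
    then show "real n / real s \<le> real (card (alg_coloring h ` vertices h))"
      using assms(2) by (simp add: field_simps)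
  qed
  show "presenter_uses_at_most n k (hue_strategy k s) (real n / real k + 2 * real s)"
    unfolding presenter_uses_at_most_def
  proof (intro allI impI)
    fix h assume h: "play k (hue_strategy k s) h \<and> length h = n"
    then have "pres_coloring h ` vertices h \<subseteq> {..<card (exhausted k h) + 2 * s}"
      using inv by (simp add: hue_invariant_def)
    then have "card (pres_coloring h ` vertices h) \<le> card (exhausted k h) + 2 * s"
      using card_mono[OF finite_lessThan] by (metis card_lessThan)
    \<comment> \<open>Each exhausted color occupies at least \<open>k\<close> of the
      \<open>n\<close> vertices.\<close>
    moreover have "real k * real (card (exhausted k h)) \<le> real n"
      using exhausted_bound(2)[OF assms(1), of h] h by (metis of_nat_le_iff of_nat_mult)
    then have "real (card (exhausted k h)) \<le> real n / real k"
      using assms(1) by (simp add: field_simps)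
    ultimately show "real (card (pres_coloring h ` vertices h)) \<le> real n / real k + 2 * real s"
      by linarith
  qed
qed

text \<open>By \<open>4^s / (2s) \<le> (2s choose s)\<close>, the last condition follows from
  \<open>n \<le> 2^(2s-1)\<close>, that is, \<open>2s \<ge> log n + 1\<close>. The closed window
  from \<open>log n + 1\<close> to \<open>log n + 3\<close> has length 2 and so contains an even
  integer.\<close>

lemma half_log_central_binomial:
  fixes n :: nat
  assumes "n \<ge> 2"
  obtains s :: nat where "s \<ge> 1" and "2 * real s \<le> log 2 (real n) + 3"
    and "n \<le> s * (2 * s choose s)"
proof
  define L where "L = nat \<lfloor>log 2 (real n)\<rfloor>"
  \<comment> \<open>Rounding down loses at most one: \<open>L + 2 \<le> 2 * s \<le> L + 3\<close>.
    The lower estimate gives the exponent \<open>2 * s - 1 \<ge> L + 1\<close> below.\<close>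
  define s where "s = (L + 3) div 2"
  show s1: "s \<ge> 1" by (simp add: s_def)
  have log0: "0 \<le> log 2 (real n)" using assms by simp
  then have L: "real L \<le> log 2 (real n)" "log 2 (real n) < real L + 1"
    unfolding L_def by linarith+
  have "2 * s \<le> L + 3" by (simp add: s_def)
  then show "2 * real s \<le> log 2 (real n) + 3" using L(1) by linarith
  have "real n = 2 powr log 2 (real n)" using assms by simp
  also have "\<dots> \<le> 2 powr real (L + 1)" using L(2) by (intro powr_mono) auto
  also have "\<dots> = 2 ^ (L + 1)" by (rule powr_realpow) simp
  also have "\<dots> \<le> 2 ^ (2 * s - 1)" by (rule power_increasing) (auto simp: s_def)
  also have "\<dots> = 4 ^ s / 2"
    using s1 by (cases s) (simp_all add: power_mult)
  also have "\<dots> = real s * (4 ^ s / (2 * real s))" using s1 by simp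
  also have "\<dots> \<le> real s * real (2 * s choose s)"
    using central_binomial_lower_bound[of s] s1 by (intro mult_left_mono) simp_all
  finally show "n \<le> s * (2 * s choose s)" by (metis of_nat_le_iff of_nat_mult)
qed

lemma forces_colors_mono: "forces_colors n k S c \<Longrightarrow> d \<le> c \<Longrightarrow> forces_colors n k S d"
  unfolding forces_colors_def by (blast intro: order_trans)

lemma presenter_uses_at_most_mono:
  "presenter_uses_at_most n k S c \<Longrightarrow> c \<le> d \<Longrightarrow> presenter_uses_at_most n k S d"
  unfolding presenter_uses_at_most_def by (blast intro: order_trans)

theorem theorem1:
  fixes n k :: nat
  assumes "n \<ge> 2" and "k \<ge> 1"
  shows "\<exists>S. transparent_strategy n k S \<and>
    forces_colors n k S (2 * (real n / (log 2 (real n) + 3))) \<and>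
    presenter_uses_at_most n k S (real n / real k + log 2 (real n) + 3)"
proof -
  obtain s where s: "s \<ge> 1" "2 * real s \<le> log 2 (real n) + 3" "n \<le> s * (2 * s choose s)"
    using half_log_central_binomial[OF assms(1)] .
  \<comment> \<open>Replacing the denominator by the smaller \<open>2 * real s\<close> only
    increases the quotient.\<close>
  have "2 * (real n / (log 2 (real n) + 3)) \<le> 2 * (real n / (2 * real s))"
    using s by (intro mult_left_mono divide_left_mono) auto
  then have "2 * (real n / (log 2 (real n) + 3)) \<le> real n / real s" by simp
  then have "forces_colors n k (hue_strategy k s) (2 * (real n / (log 2 (real n) + 3)))"
    by (intro forces_colors_mono[OF hue_strategy_wins(2)[OF assms(2) s(1,3)]]) simp
  moreover have "presenter_uses_at_most n k (hue_strategy k s)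
      (real n / real k + log 2 (real n) + 3)"
    using s(2)
    by (intro presenter_uses_at_most_mono[OF hue_strategy_wins(3)[OF assms(2) s(1,3)]]) simp
  ultimately show ?thesis using hue_strategy_wins(1)[OF assms(2) s(1,3)] by blast
qed

end
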